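(* Let $F$ be an ordered field with an integer part $I$, and let $\alpha,\beta\in F$ be positive irrationals such that $\alpha^{-1}+\beta^{-1}=1$. Then $N_{\alpha}\cap N_{\beta}=\{0\}$ and $N_{\alpha}\cup N_{\beta}=I^{\geqslant 0}$.
   Context: A subring $I$ of an ordered field $F$ is an integer part of $F$ if $I$ is discretely ordered (no $x\in I$ satisfies $0<x<1$) and for every $x\in F$ there is a (necessarily unique) $a\in I$ with $a\leqslant x<a+1$; this $a$ is denoted $\lfloor x\rfloor$. $I^{\geqslant 0}=\{x\in I: x\geqslant 0\}$. An element of $F$ is rational if it lies in the fraction field $\mathrm{Frac}(I)\subseteq F$, and irrational otherwise. For $\alpha\in F$ positive, $N_\alpha=\{\lfloor n\alpha\rfloor : n\in I^{\geqslant 0}\}$. *)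

theory Defs
  imports Main
begin

(* The ordered field F is the whole type 'a of class linordered_field, and the rings
   are subsets of it.  HOL-Algebra's subring refers to record-based rings, hence the
   set-based version here; subrings contain 1. *)
definition is_subring :: "'a::linordered_field set \<Rightarrow> bool" where
  "is_subring I \<longleftrightarrow>
     0 \<in> I \<and> 1 \<in> I \<and>
     (\<forall>x\<in>I. \<forall>y\<in>I. x + y \<in> I) \<and>
     (\<forall>x\<in>I. - x \<in> I) \<and>
     (\<forall>x\<in>I. \<forall>y\<in>I. x * y \<in> I)"

definition discretely_ordered :: "'a::linordered_field set \<Rightarrow> bool" where
  "discretely_ordered I \<longleftrightarrow> \<not> (\<exists>x\<in>I. 0 < x \<and> x < 1)"

definition integer_part :: "'a::linordered_field set \<Rightarrow> bool" where
  "integer_part I \<longleftrightarrow>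
     is_subring I \<and> discretely_ordered I \<and> (\<forall>x. \<exists>a\<in>I. a \<le> x \<and> x < a + 1)"

(* The library's floor is only available for archimedean fields and takes values in int. *)
definition floor_in :: "'a::linordered_field set \<Rightarrow> 'a \<Rightarrow> 'a" where
  "floor_in I x = (THE a. a \<in> I \<and> a \<le> x \<and> x < a + 1)"

definition nonneg_part :: "'a::linordered_field set \<Rightarrow> 'a set" where
  "nonneg_part I = {x \<in> I. 0 \<le> x}"

definition Frac :: "'a::linordered_field set \<Rightarrow> 'a set" where
  "Frac I = {a / b | a b. a \<in> I \<and> b \<in> I \<and> b \<noteq> 0}"

definition irrational_over :: "'a::linordered_field set \<Rightarrow> 'a \<Rightarrow> bool" where
  "irrational_over I x \<longleftrightarrow> x \<notin> Frac I"

definition beatty_set :: "'a::linordered_field set \<Rightarrow> 'a \<Rightarrow> 'a set" where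
  "beatty_set I \<alpha> = {floor_in I (n * \<alpha>) | n. n \<in> nonneg_part I}"

lemma integer_part_floor_unique:
  assumes "integer_part I"
  shows "\<exists>!a. a \<in> I \<and> a \<le> x \<and> x < a + 1"
proof -
  have le: "b \<le> a" if "a \<in> I" "b \<in> I" "x < a + 1" "b \<le> x" for a b
  proof (rule ccontr)
    assume "\<not> b \<le> a"
    then have "0 < b + - a" "b + - a < 1"
      using that by (auto simp: algebra_simps)
    moreover have "b + - a \<in> I"
      using assms that unfolding integer_part_def is_subring_def by blast
    ultimately show False
      using assms unfolding integer_part_def discretely_ordered_def by blast
  qed
  obtain a where "a \<in> I" "a \<le> x" "x < a + 1"
    using assms unfolding integer_part_def by blast
  then show ?thesis
    by (meson le order_antisym)
qed

end

theory Submission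
  imports Defs
begin

text \<open>
  Put \<open>a = inverse \<alpha>\<close> and \<open>b = inverse \<beta>\<close>, so \<open>a + b = 1\<close>. For \<open>k > 0\<close> in \<open>I\<close>, the condition
  \<open>k \<le> n * \<alpha> < k + 1\<close> says that \<open>n\<close> lies between \<open>k * a\<close> and \<open>(k + 1) * a\<close>. If \<open>m\<close> is the integer
  part of \<open>k * a\<close>, such an \<open>n\<close> exists in \<open>I\<close> exactly when the next element \<open>m + 1\<close> already lies below
  \<open>(k + 1) * a\<close> (lemma \<open>mem_beatty_set_iff_next_less\<close>). Since \<open>k * b = k - k * a\<close>, the integer part of
  \<open>k * b\<close> is \<open>k - m - 1\<close>, and the same criterion puts \<open>k\<close> in the set of \<open>\<beta>\<close> exactly when
  \<open>k - m < (k + 1) * b\<close>, that is, when \<open>(k + 1) * a < m + 1\<close>. Irrationality excludes equality, so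
  precisely one of the two cases occurs.

  The classical density argument, which counts the members of each sequence below a bound, relies
  on the archimedean property; the comparison above is local at each \<open>k\<close>, and so it works in any
  ordered field with an integer part.
\<close>

lemma integer_part_closed:
  assumes "integer_part I"
  shows "0 \<in> I" "1 \<in> I"
    and "\<lbrakk>x \<in> I; y \<in> I\<rbrakk> \<Longrightarrow> x + y \<in> I"
    and "\<lbrakk>x \<in> I; y \<in> I\<rbrakk> \<Longrightarrow> x - y \<in> I"
proof -
  show "0 \<in> I" "1 \<in> I" "\<lbrakk>x \<in> I; y \<in> I\<rbrakk> \<Longrightarrow> x + y \<in> I"
    using assms by (auto simp: integer_part_def is_subring_def)
  show "x - y \<in> I" if "x \<in> I" "y \<in> I"
    using assms that unfolding integer_part_def is_subring_def
    by (metis add_uminus_conv_diff)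
qed

lemma integer_part_less_add_one:
  assumes "integer_part I" "x \<in> I" "y \<in> I" "x < y + 1"
  shows "x \<le> y"
proof (rule ccontr)
  assume "\<not> x \<le> y"
  then have "0 < x - y" "x - y < 1"
    using assms(4) by (auto simp: algebra_simps)
  moreover have "x - y \<in> I"
    by (rule integer_part_closed(4)[OF assms(1-3)])
  ultimately show False
    using assms(1) unfolding integer_part_def discretely_ordered_def by blast
qed

lemma floor_in_eq_iff:
  assumes "integer_part I"
  shows "floor_in I x = k \<longleftrightarrow> k \<in> I \<and> k \<le> x \<and> x < k + 1"
  unfolding floor_in_def
  using theI'[OF integer_part_floor_unique[OF assms, of x]]
    the1_equality[OF integer_part_floor_unique[OF assms, of x], of k]
  by metis

lemma mem_beatty_set_iff:
  assumes "integer_part I"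
  shows "k \<in> beatty_set I \<alpha> \<longleftrightarrow>
    k \<in> I \<and> (\<exists>n\<in>I. 0 \<le> n \<and> k \<le> n * \<alpha> \<and> n * \<alpha> < k + 1)"
proof -
  have "k \<in> beatty_set I \<alpha> \<longleftrightarrow> (\<exists>n\<in>nonneg_part I. floor_in I (n * \<alpha>) = k)"
    unfolding beatty_set_def by auto
  then show ?thesis
    unfolding floor_in_eq_iff[OF assms] nonneg_part_def by auto
qed

lemma beatty_set_subset_nonneg_part:
  assumes "integer_part I" "0 < \<alpha>"
  shows "beatty_set I \<alpha> \<subseteq> nonneg_part I"
proof
  fix k assume "k \<in> beatty_set I \<alpha>"
  then obtain n where n: "k \<in> I" "0 \<le> n" "n * \<alpha> < k + 1"
    unfolding mem_beatty_set_iff[OF assms(1)] by blast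
  have "0 \<le> n * \<alpha>"
    using n(2) assms(2) by simp
  also note n(3)
  finally have "0 \<le> k"
    by (rule integer_part_less_add_one[OF assms(1) integer_part_closed(1)[OF assms(1)] n(1)])
  with n(1) show "k \<in> nonneg_part I"
    by (simp add: nonneg_part_def)
qed

lemma zero_mem_beatty_set:
  assumes "integer_part I"
  shows "0 \<in> beatty_set I \<alpha>"
  unfolding mem_beatty_set_iff[OF assms]
  using integer_part_closed(1)[OF assms] by (auto intro!: bexI[of _ 0])

lemma irrational_over_mult_inverse_neq:
  assumes "irrational_over I \<alpha>" "0 < \<alpha>" "k \<in> I" "n \<in> I" "k \<noteq> 0"
  shows "k * inverse \<alpha> \<noteq> n"
proof
  assume "k * inverse \<alpha> = n"
  then have "k = n * \<alpha>"
    using assms(2) by (auto simp: field_simps)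
  moreover from this have "n \<noteq> 0"
    using assms(5) by auto
  ultimately have "\<alpha> = k / n"
    by simp
  then show False
    using assms(1,3,4) \<open>n \<noteq> 0\<close> unfolding irrational_over_def Frac_def by blast
qed

text \<open>
  A multiplier \<open>n\<close> for \<open>k\<close> must exceed \<open>k * inverse \<alpha>\<close>, hence be at least \<open>m + 1\<close>; so if any
  multiplier works, then \<open>m + 1\<close> does.
\<close>

lemma mem_beatty_set_iff_next_less:
  assumes I: "integer_part I" and "0 < \<alpha>"
    and k: "k \<in> I" "0 < k" and m: "m \<in> I"
    and less: "m < k * inverse \<alpha>" "k * inverse \<alpha> < m + 1"
  shows "k \<in> beatty_set I \<alpha> \<longleftrightarrow> m + 1 < (k + 1) * inverse \<alpha>"
proof -
  have eq: "k \<le> n * \<alpha> \<longleftrightarrow> k * inverse \<alpha> \<le> n"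
    "n * \<alpha> < k + 1 \<longleftrightarrow> n < (k + 1) * inverse \<alpha>" for n
    using \<open>0 < \<alpha>\<close> by (simp_all add: field_simps)
  have pos: "0 < k * inverse \<alpha>"
    using k \<open>0 < \<alpha>\<close> by simp
  show ?thesis
    unfolding mem_beatty_set_iff[OF I] eq
  proof safe
    fix n assume n: "n \<in> I" "k * inverse \<alpha> \<le> n" "n < (k + 1) * inverse \<alpha>"
    have "m + 1 \<le> n"
      using integer_part_less_add_one[OF I, of "m + 1" n] n less(1) m
        integer_part_closed[OF I] by auto
    with n(3) show "m + 1 < (k + 1) * inverse \<alpha>"
      by simp
  next
    assume "m + 1 < (k + 1) * inverse \<alpha>"
    moreover have "m + 1 \<in> I"
      by (intro m integer_part_closed[OF I])
    ultimately show "\<exists>n\<in>I. 0 \<le> n \<and> k * inverse \<alpha> \<le> n \<and> n < (k + 1) * inverse \<alpha>"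
      using less(2) pos by (intro bexI[of _ "m + 1"]) auto
  qed (rule k)
qed

lemma positive_mem_exactly_one_beatty_set:
  assumes I: "integer_part I"
    and \<alpha>: "0 < \<alpha>" "irrational_over I \<alpha>"
    and "0 < \<beta>" "inverse \<alpha> + inverse \<beta> = 1"
    and k: "k \<in> I" "0 < k"
  shows "k \<in> beatty_set I \<alpha> \<longleftrightarrow> k \<notin> beatty_set I \<beta>"
proof -
  note closed = integer_part_closed[OF I]
  have \<beta>: "inverse \<beta> = 1 - inverse \<alpha>"
    using assms(5) by (simp add: algebra_simps)
  obtain m where m: "m \<in> I" "m \<le> k * inverse \<alpha>" "k * inverse \<alpha> < m + 1"
    using I unfolding integer_part_def by blast
  with irrational_over_mult_inverse_neq[OF \<alpha>(2,1) k(1) m(1)] k(2)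
  have less: "m < k * inverse \<alpha>"
    by auto
  have "k \<in> beatty_set I \<alpha> \<longleftrightarrow> m + 1 < (k + 1) * inverse \<alpha>"
    by (rule mem_beatty_set_iff_next_less[OF I \<alpha>(1) k m(1) less m(3)])
  also have "\<dots> \<longleftrightarrow> \<not> (k + 1) * inverse \<alpha> < m + 1"
    using irrational_over_mult_inverse_neq[OF \<alpha>(2,1), of "k + 1" "m + 1"] k m(1) closed
    by auto
  also have "(k + 1) * inverse \<alpha> < m + 1 \<longleftrightarrow> (k - m - 1) + 1 < (k + 1) * inverse \<beta>"
    unfolding \<beta> by (auto simp: algebra_simps)
  also have "\<dots> \<longleftrightarrow> k \<in> beatty_set I \<beta>"
  proof (rule mem_beatty_set_iff_next_less[OF I \<open>0 < \<beta>\<close> k, symmetric])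
    show "k - m - 1 \<in> I"
      by (intro closed k(1) m(1))
    show "k - m - 1 < k * inverse \<beta>" "k * inverse \<beta> < k - m - 1 + 1"
      unfolding \<beta> using less m(3) by (simp_all add: algebra_simps)
  qed
  finally show ?thesis .
qed

theorem theorem2p5:
  fixes I :: "'a::linordered_field set"
    and \<alpha> \<beta> :: 'a
  assumes "integer_part I"
    and "0 < \<alpha>" and "irrational_over I \<alpha>"
    and "0 < \<beta>" and "irrational_over I \<beta>"
    and "inverse \<alpha> + inverse \<beta> = 1"
  shows "beatty_set I \<alpha> \<inter> beatty_set I \<beta> = {0} \<and>
         beatty_set I \<alpha> \<union> beatty_set I \<beta> = nonneg_part I"
proof -
  have sub: "beatty_set I \<alpha> \<subseteq> nonneg_part I" "beatty_set I \<beta> \<subseteq> nonneg_part I"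
    by (rule beatty_set_subset_nonneg_part[OF assms(1)], fact)+
  have zero: "0 \<in> beatty_set I \<alpha>" "0 \<in> beatty_set I \<beta>"
    by (rule zero_mem_beatty_set[OF assms(1)])+
  have pos: "k \<in> beatty_set I \<alpha> \<longleftrightarrow> k \<notin> beatty_set I \<beta>"
    if "k \<in> nonneg_part I" "k \<noteq> 0" for k
    using positive_mem_exactly_one_beatty_set[OF assms(1-4,6), of k] that
    by (auto simp: nonneg_part_def)
  show ?thesis
    using sub zero pos by (intro conjI equalityI subsetI) auto
qed

end
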